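(* Let $n \ge 2$ and $m \ge 1$ be integers, and let $\{x_0, x_1, \ldots, x_m\}$ be a set of $m+1$ distinct points of the Hamming cube $H_n$ with $x_0 = \mathbf{0}$. If the vectors $x_1, x_2, \ldots, x_m$ are linearly independent in $\mathbb{R}^n$, then \[ \det(D) = (-1)^m 2^{m-1} \det(G)\,\langle G^{-1}u, u\rangle = (-1)^m 2^{m-1} V^2 \langle G^{-1}u, u\rangle, \] where $V$ is the $m$-dimensional volume of the parallelepiped with sides $x_1, x_2, \ldots, x_m$. In particular, $\det(D) \neq 0$.
   Context: $H_n$ is the set $\{0,1\}^n \subset \mathbb{R}^n$ with the metric $d(x,y) = \|x-y\|_1 = \sum_{k=1}^n |x_k - y_k|$. $\mathbf{0}$ is the zero vector of $\mathbb{R}^n$. $D = (d(x_i,x_j))_{i,j=0}^m$ is the $(m+1)\times(m+1)$ distance matrix. $G = (x_i \cdot x_j)_{i,j=1}^m$ is the $m \times m$ Gram matrix of $x_1,\ldots,x_m$ (it is invertible when these vectors are linearly independent). $u = (x_1\cdot x_1, \ldots, x_m \cdot x_m)^T \in \mathbb{R}^m$. $\langle\cdot,\cdot\rangle$ is the standard real inner product, so $\langle G^{-1}u,u\rangle = u^T G^{-1} u$. The parallelepiped with sides $x_1,\dots,x_m$ is $\{t_1x_1+\cdots+t_mx_m : t_k\in[0,1],\ 1\le k\le m\}$. *)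

theory Defs
  imports "HOL-Analysis.Analysis"
begin

definition hamming_cube :: "(real ^ 'n) set" where
  "hamming_cube = {x. \<forall>k. x $ k \<in> {0, 1}}"

text \<open>The \<open>l1\<close> metric; the library's \<^const>\<open>dist\<close> on \<open>real ^ 'n\<close> is the Euclidean one.\<close>

definition l1_dist :: "real ^ 'n \<Rightarrow> real ^ 'n \<Rightarrow> real" where
  "l1_dist x y = (\<Sum>k\<in>UNIV. \<bar>x $ k - y $ k\<bar>)"

text \<open>
  Matrices are indexed by arbitrary finite types. A family of \<open>m + 1\<close> points
  \<open>x 0, \<dots>, x m\<close> is meant to be indexed by \<open>'m option\<close> with \<open>CARD('m) = m\<close>, where
  \<open>None\<close> plays the role of the index \<open>0\<close>; determinants do not depend on how the indices
  are ordered.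
\<close>

definition distance_matrix :: "('a \<Rightarrow> real ^ 'n) \<Rightarrow> real ^ 'a ^ 'a" where
  "distance_matrix x = (\<chi> i j. l1_dist (x i) (x j))"

definition gram_matrix :: "('a \<Rightarrow> real ^ 'n) \<Rightarrow> real ^ 'a ^ 'a" where
  "gram_matrix v = (\<chi> i j. v i \<bullet> v j)"

definition gram_diagonal :: "('a \<Rightarrow> real ^ 'n) \<Rightarrow> real ^ 'a" where
  "gram_diagonal v = (\<chi> i. v i \<bullet> v i)"

definition parallelepiped :: "('a::finite \<Rightarrow> real ^ 'n) \<Rightarrow> (real ^ 'n) set" where
  "parallelepiped v = {\<Sum>k\<in>UNIV. t k *\<^sub>R v k | t. \<forall>k. t k \<in> {0..1}}"

text \<open>
  Versions of the library's \<open>measure_orthogonal_image\<close>, which needs a well-ordered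
  index type; used only to show that the volume defined below is well defined.
\<close>

lemma measure_orthogonal_image_box:
  fixes k :: "'a::euclidean_space \<Rightarrow> 'a"
  assumes k: "orthogonal_transformation k"
  shows "measure lebesgue (k ` box a b) = measure lebesgue (box a b)"
proof -
  define K where "K = {(c, r). ball c r \<subseteq> box a b}"
  obtain C where C: "countable C" "C \<subseteq> K"
    "pairwise (\<lambda>i j. disjnt (ball (fst i) (snd i)) (ball (fst j) (snd j))) C"
    "negligible (box a b - (\<Union>i\<in>C. ball (fst i) (snd i)))"
  proof (rule Vitali_covering_theorem_balls[of "box a b" K fst snd])
    fix x :: 'a and d :: real
    assume x: "x \<in> box a b" and d: "0 < d"
    obtain e where e: "e > 0" "ball x e \<subseteq> box a b"
      using open_contains_ball[of "box a b"] x by (auto simp: open_box)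
    have "ball x (min e (d / 2)) \<subseteq> ball x e" by auto
    then have "(x, min e (d / 2)) \<in> K" using e by (auto simp: K_def)
    then show "\<exists>i. i \<in> K \<and> x \<in> ball (fst i) (snd i) \<and> snd i < d"
      using e d by (intro exI[of _ "(x, min e (d / 2))"]) auto
  qed
  define B where "B = (\<Union>i\<in>C. ball (fst i) (snd i))"
  have "B \<subseteq> box a b" using C(2) by (fastforce simp: B_def K_def)
  have lin: "linear k" and "inj k" using k orthogonal_transformation_linear orthogonal_transformation_inj by auto
  have im: "k ` B = (\<Union>i\<in>C. ball (k (fst i)) (snd i))"
    by (simp add: B_def image_UN image_orthogonal_transformation_ball[OF k])
  have dis: "disjoint_family_on (\<lambda>i. ball (fst i) (snd i)) C"
    using C(3) by (auto simp: disjoint_family_on_def pairwise_def disjnt_def)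
  then have "disjoint_family_on (\<lambda>i. k ` ball (fst i) (snd i)) C"
    using \<open>inj k\<close> by (auto simp: disjoint_family_on_def simp flip: image_Int)
  then have dis': "disjoint_family_on (\<lambda>i. ball (k (fst i)) (snd i)) C"
    by (simp add: image_orthogonal_transformation_ball[OF k])
  have ball: "emeasure lebesgue (ball (k c) r) = emeasure lebesgue (ball c r)" for c r
    by (cases "r \<ge> 0") (simp_all add: emeasure_ball ball_empty)
  have "emeasure lebesgue (k ` B) = emeasure lebesgue B"
    unfolding im unfolding B_def
    by (simp add: emeasure_UN_countable C(1) dis dis' ball)
  then have eq: "measure lebesgue (k ` B) = measure lebesgue B" by (simp add: measure_def)
  have negk: "negligible (k ` (box a b - B))"
    using C(4) lin
    by (intro negligible_differentiable_image_negligible)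
       (auto simp: B_def intro: linear_imp_differentiable_on)
  have "bounded B" using \<open>B \<subseteq> box a b\<close> bounded_box bounded_subset by blast
  then have "bounded (k ` B)" using lin by (simp add: bounded_linear_image linear_linear)
  moreover have "open B" "open (k ` B)" unfolding im unfolding B_def by auto
  ultimately have "B \<in> lmeasurable" "k ` B \<in> lmeasurable"
    using \<open>bounded B\<close> by (simp_all add: lmeasurable_open)
  have "measure lebesgue (box a b) = measure lebesgue B"
  proof (rule measure_negligible_symdiff[OF \<open>B \<in> lmeasurable\<close>])
    have "B - box a b \<union> (box a b - B) = box a b - B" using \<open>B \<subseteq> box a b\<close> by blast
    then show "negligible (B - box a b \<union> (box a b - B))" using C(4) by (simp add: B_def)
  qed
  moreover have "measure lebesgue (k ` box a b) = measure lebesgue (k ` B)"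
  proof (rule measure_negligible_symdiff[OF \<open>k ` B \<in> lmeasurable\<close>])
    have "k ` B - k ` box a b \<union> (k ` box a b - k ` B) \<subseteq> k ` (box a b - B)"
      using \<open>B \<subseteq> box a b\<close> by auto
    with negk show "negligible (k ` B - k ` box a b \<union> (k ` box a b - k ` B))"
      by (rule negligible_subset)
  qed
  ultimately show ?thesis using eq by simp
qed

lemma measure_orthogonal_image_eq:
  fixes k :: "'a::euclidean_space \<Rightarrow> 'a"
  assumes k: "orthogonal_transformation k"
  shows "measure lebesgue (k ` S) = measure lebesgue S"
proof -
  have *: "h ` T \<in> lmeasurable \<and> measure lebesgue (h ` T) = measure lebesgue T"
    if h: "orthogonal_transformation h" and T: "T \<in> lmeasurable" for h :: "'a \<Rightarrow> 'a" and T
  proof -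
    have lin: "linear h" using h orthogonal_transformation_linear by blast
    have "measure lebesgue (h ` cbox a b) = 1 * measure lebesgue (cbox a b)" for a b :: 'a
    proof -
      have "negligible (h ` (cbox a b - box a b))"
        using lin
        by (intro negligible_differentiable_image_negligible)
           (auto simp: negligible_frontier_interval intro: linear_imp_differentiable_on)
      then have "negligible ((h ` box a b - h ` cbox a b) \<union> (h ` cbox a b - h ` box a b))"
        by (rule negligible_subset) (use box_subset_cbox[of a b] in auto)
      moreover have "h ` box a b \<in> lmeasurable"
      proof -
        have "open (h ` box a b)"
          using lin h by (intro open_surjective_linear_image orthogonal_transformation_surj) (auto simp: open_box)
        moreover have "bounded (h ` box a b)"
          using lin by (intro bounded_linear_image) (auto simp: linear_linear)
        ultimately show ?thesis by (simp add: lmeasurable_open)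
      qed
      ultimately have "measure lebesgue (h ` cbox a b) = measure lebesgue (h ` box a b)"
        by (metis measure_negligible_symdiff)
      then show ?thesis by (simp add: measure_orthogonal_image_box[OF h] measure_lborel_box_eq measure_lborel_cbox_eq)
    qed
    then show ?thesis using measure_linear_sufficient[OF lin T, of 1] by simp
  qed
  show ?thesis
  proof (cases "S \<in> lmeasurable")
    case True
    then show ?thesis using *[OF k] by simp
  next
    case False
    have "inv k ` k ` S = S"
      using orthogonal_transformation_inj[OF k] by (simp add: image_inv_f_f)
    then have "k ` S \<notin> lmeasurable"
      using False *[OF orthogonal_transformation_inv[OF k], of "k ` S"] by auto
    moreover have "measure lebesgue T = 0" if "T \<notin> lmeasurable" for T :: "'a set"
      using that by (cases "T \<in> sets lebesgue")
        (auto simp: fmeasurable_def measure_def emeasure_notin_sets less_top[symmetric]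
          simp del: emeasure_completion)
    ultimately show ?thesis using False by simp
  qed
qed

definition linear_isometry :: "('a::real_normed_vector \<Rightarrow> 'b::real_normed_vector) \<Rightarrow> bool" where
  "linear_isometry f \<longleftrightarrow> linear f \<and> (\<forall>v. norm (f v) = norm v)"

text \<open>
  The \<open>CARD('m)\<close>-dimensional volume of a subset \<open>S\<close> of some \<open>CARD('m)\<close>-dimensional linear
  subspace of a Euclidean space: Lebesgue measure, transported along a linear isometry of
  \<open>real ^ 'm\<close> onto such a subspace. The value does not depend on the isometry; see
  \<open>subspace_volume_eq\<close> below. It is unspecified if \<open>S\<close> lies in no such subspace.
\<close>

definition subspace_volume :: "'m::finite itself \<Rightarrow> 'b::euclidean_space set \<Rightarrow> real" where
  "subspace_volume m S =
     measure lebesgue ((SOME f :: real ^ 'm \<Rightarrow> 'b. linear_isometry f \<and> S \<subseteq> range f) -` S)"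

lemma subspace_volume_eq:
  fixes f :: "real ^ 'm \<Rightarrow> 'b::euclidean_space"
  assumes f: "linear_isometry f" and S: "S \<subseteq> range f"
  shows "subspace_volume TYPE('m) S = measure lebesgue (f -` S)"
proof -
  have inj: "inj h" if "linear_isometry h" for h :: "real ^ 'm \<Rightarrow> 'b"
    using that unfolding linear_isometry_def
    by (metis linear_injective_0 norm_eq_zero)
  define g where "g = (SOME f :: real ^ 'm \<Rightarrow> 'b. linear_isometry f \<and> S \<subseteq> range f)"
  have g: "linear_isometry g" "S \<subseteq> range g"
    unfolding g_def using someI_ex[of "\<lambda>f :: real ^ 'm \<Rightarrow> 'b. linear_isometry f \<and> S \<subseteq> range f"] f S
    by blast+
  have lin: "linear f" "linear g" using f g by (auto simp: linear_isometry_def)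
  have dimr: "dim (range h) = CARD('m)" if "linear_isometry h" for h :: "real ^ 'm \<Rightarrow> 'b"
    using dim_image_eq[of h UNIV] inj[OF that] that by (auto simp: linear_isometry_def)
  have "measure lebesgue (g -` S) = measure lebesgue (f -` S)"
  proof (cases "dim S < CARD('m)")
    case True
    have "negligible (h -` S)" if h: "linear_isometry h" "S \<subseteq> range h" for h :: "real ^ 'm \<Rightarrow> 'b"
    proof (rule negligible_lowdim)
      have "h ` (h -` S) = S" using h(2) by auto
      moreover have "dim (h ` (h -` S)) = dim (h -` S)"
        using dim_image_eq[of h "h -` S"] inj[OF h(1)] h(1)
        by (auto simp: linear_isometry_def intro: inj_on_subset)
      ultimately show "dim (h -` S) < DIM(real ^ 'm)" using True by simp
    qed
    then show ?thesis using f S g by (simp add: negligible_imp_measure0)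
  next
    case False
    have "range h = span S" if h: "linear_isometry h" "S \<subseteq> range h" for h :: "real ^ 'm \<Rightarrow> 'b"
    proof -
      have "subspace (range h)"
        using h(1) by (auto simp: linear_isometry_def intro: linear_subspace_image)
      then show ?thesis
        using subspace_dim_equal[of "span S" "range h"] False dimr[OF h(1)] span_minimal[OF h(2)]
        by simp
    qed
    then have r: "range f = range g" using f S g by (metis (no_types))
    define k where "k = inv g \<circ> f"
    have gk: "g (k x) = f x" for x
    proof -
      have "f x \<in> range g" using r by blast
      then show ?thesis by (simp add: k_def f_inv_into_f)
    qed
    have "linear k"
    proof
      show "k (x + y) = k x + k y" for x y
        by (rule injD[OF inj[OF g(1)]]) (simp add: gk linear_add lin)
      show "k (c *\<^sub>R x) = c *\<^sub>R k x" for c x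
        by (rule injD[OF inj[OF g(1)]]) (simp add: gk linear_scale lin)
    qed
    moreover have "norm (k x) = norm x" for x
      using f g(1) gk unfolding linear_isometry_def by metis
    ultimately have k: "orthogonal_transformation k" by (simp add: orthogonal_transformation)
    have "g -` S = k ` (f -` S)"
    proof (intro equalityI subsetI)
      fix y assume y: "y \<in> g -` S"
      obtain x where "k x = y" using orthogonal_transformation_surj[OF k] by (metis surjD)
      with y show "y \<in> k ` (f -` S)" by (auto simp flip: gk)
    qed (auto simp: gk)
    then show ?thesis using measure_orthogonal_image_eq[OF k] by simp
  qed
  then show ?thesis by (simp add: subspace_volume_def g_def)
qed

end

theory Submission
  imports Defs
begin

text \<open>
  On the Hamming cube \<open>d(x, y) = x \<bullet> x + y \<bullet> y - 2 x \<bullet> y\<close>, so subtracting the row and the column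
  of the origin from the others turns \<open>D\<close> into \<open>- 2 G\<close> bordered by \<open>u\<close> with corner \<open>0\<close>. Adding
  \<open>G\<^sup>-\<^sup>1 u / 2\<close> times the lower rows to the first one clears the upper border and leaves
  \<open>\<langle>G\<^sup>-\<^sup>1 u, u\<rangle> / 2\<close> in the corner. In orthonormal coordinates on the span of the sides,
  \<open>G = A\<^sup>T A\<close> for the matrix \<open>A\<close> whose columns are the sides, hence \<open>det G = V\<^sup>2\<close>; and \<open>det D\<close> does not
  vanish because \<open>G\<close> is positive definite and \<open>u \<noteq> 0\<close>.
\<close>

section \<open>Determinants of bordered matrices\<close>

definition bordered_matrix ::
    "'a::comm_ring_1 \<Rightarrow> 'a ^ 'm \<Rightarrow> 'a ^ 'm \<Rightarrow> 'a ^ 'm ^ 'm \<Rightarrow> 'a ^ 'm option ^ 'm option" where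
  "bordered_matrix a r c H = (\<chi> i j. case i of
      None \<Rightarrow> (case j of None \<Rightarrow> a | Some j \<Rightarrow> r $ j)
    | Some i \<Rightarrow> (case j of None \<Rightarrow> c $ i | Some j \<Rightarrow> H $ i $ j))"

lemma bordered_matrix_nth [simp]:
  "bordered_matrix a r c H $ None $ None = a"
  "bordered_matrix a r c H $ None $ Some j = r $ j"
  "bordered_matrix a r c H $ Some i $ None = c $ i"
  "bordered_matrix a r c H $ Some i $ Some j = H $ i $ j"
  by (simp_all add: bordered_matrix_def)

lemma option_matrix_eq_iff:
  "A = B \<longleftrightarrow> A $ None $ None = B $ None $ None \<and> (\<forall>j. A $ None $ Some j = B $ None $ Some j)
    \<and> (\<forall>i. A $ Some i $ None = B $ Some i $ None)
    \<and> (\<forall>i j. A $ Some i $ Some j = B $ Some i $ Some j)"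
  by (auto simp: vec_eq_iff split_option_all)

lemma sum_UNIV_option: "(\<Sum>i\<in>UNIV. f i) = f None + (\<Sum>i\<in>UNIV. f (Some (i::'m::finite)))"
  by (simp add: UNIV_option_conv sum.reindex)

lemma prod_UNIV_option: "(\<Prod>i\<in>UNIV. f i) = f None * (\<Prod>i\<in>UNIV. f (Some (i::'m::finite)))"
  by (simp add: UNIV_option_conv prod.reindex)

text \<open>Block multiplication. With it, row and column operations become products with
  unitriangular bordered matrices.\<close>

lemma bordered_matrix_mult:
  "bordered_matrix a r c H ** bordered_matrix a' r' c' H' =
    bordered_matrix (a * a' + (\<Sum>k\<in>UNIV. r $ k * c' $ k)) (a *s r' + r v* H')
      (a' *s c + H *v c') (\<chi> i j. c $ i * r' $ j + (H ** H') $ i $ j)"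
  by (simp add: option_matrix_eq_iff matrix_matrix_mult_def matrix_vector_mult_def
      vector_matrix_mult_def sum_UNIV_option mult.commute)

lemma transpose_bordered_matrix:
  "transpose (bordered_matrix a r c H) = bordered_matrix a c r (transpose H)"
  by (simp add: option_matrix_eq_iff transpose_def)

text \<open>A permutation moving \<open>None\<close> picks a zero from the first row, so only those
  fixing \<open>None\<close> survive in the Leibniz sum.\<close>

lemma det_bordered_matrix_lower:
  fixes H :: "'a::comm_ring_1 ^ 'm ^ 'm"
  shows "det (bordered_matrix a 0 c H) = a * det H"
proof -
  let ?M = "bordered_matrix a 0 c H"
  let ?g = "\<lambda>p. of_int (sign p) * (\<Prod>i\<in>UNIV. ?M $ i $ p i)"
  have inj: "inj (Some :: 'm \<Rightarrow> _)" by simp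
  have "det ?M = (\<Sum>p | p permutes (range Some). ?g p)"
    unfolding det_def
  proof (rule sum.mono_neutral_right)
    show "\<forall>p\<in>{p. p permutes UNIV} - {p. p permutes range Some}. ?g p = 0"
    proof
      fix p :: "'m option \<Rightarrow> 'm option"
      assume p: "p \<in> {p. p permutes UNIV} - {p. p permutes range Some}"
      have "p None \<noteq> None"
      proof
        assume None: "p None = None"
        have "p permutes range Some"
        proof (rule permutes_superset)
          show "p permutes UNIV" using p by simp
          show "p z = z" if "z \<in> UNIV - range Some" for z
            using that None by (cases z) auto
        qed
        then show False using p by simp
      qed
      then show "?g p = 0" by (auto simp: prod_UNIV_option)
    qed
  qed (auto intro: permutes_subset)
  \<comment> \<open>Transport along \<open>Some\<close>, with inverse \<open>the\<close>, keeps
    signs; the fixed point \<open>None\<close> contributes the factor \<open>a\<close>.\<close>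
  also have "\<dots> = (\<Sum>q | q permutes (UNIV :: 'm set).
      of_int (sign q) * (a * (\<Prod>i\<in>UNIV. H $ i $ q i)))"
  proof (rule sum.reindex_bij_witness[of _ "map_permutation UNIV Some"
        "map_permutation (range Some) the"])
    fix p :: "'m option \<Rightarrow> 'm option"
    assume "p \<in> {p. p permutes range Some}"
    then have p: "p permutes range Some" by simp
    have the: "bij_betw the (range Some) (UNIV :: 'm set)"
      by (rule bij_betwI[of _ _ _ Some]) auto
    show 1: "map_permutation UNIV Some (map_permutation (range Some) the p) = p"
      by (rule map_permutation_compose_inv[OF the p]) auto
    show 2: "map_permutation (range Some) the p \<in> {q. q permutes UNIV}"
      using map_permutation_permutes[OF the p] by simp
    let ?q = "map_permutation (range Some) the p"
    have "sign p = sign ?q"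
      using the p by (simp add: sign_map_permutation bij_betw_def)
    moreover have "p None = None" using p by (rule permutes_not_in) auto
    moreover have "p (Some i) = Some (?q i)" for i
      using map_permutation_apply[OF inj, of i ?q] 1 by simp
    ultimately show "of_int (sign ?q) * (a * (\<Prod>i\<in>UNIV. H $ i $ ?q i)) = ?g p"
      by (simp add: prod_UNIV_option)
  next
    fix q :: "'m \<Rightarrow> 'm"
    assume "q \<in> {q. q permutes UNIV}"
    then have q: "q permutes UNIV" by simp
    have bij: "bij_betw Some (UNIV :: 'm set) (range Some)"
      using inj by (simp add: bij_betw_def)
    show "map_permutation (range Some) the (map_permutation UNIV Some q) = q"
      by (rule map_permutation_compose_inv[OF bij q]) auto
    show "map_permutation UNIV Some q \<in> {p. p permutes range Some}"
      using map_permutation_permutes[OF bij q] by simp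
  qed
  also have "\<dots> = a * det H"
    by (simp add: det_def sum_distrib_left mult.left_commute)
  finally show ?thesis .
qed

lemma det_bordered_matrix_upper:
  fixes H :: "'a::comm_ring_1 ^ 'm ^ 'm"
  shows "det (bordered_matrix a r 0 H) = a * det H"
  using det_bordered_matrix_lower[of a r "transpose H"]
  by (metis det_transpose transpose_bordered_matrix transpose_transpose)

text \<open>Adding the \<open>w\<close>-combination of the lower rows to the first clears
  \<open>r\<close>. The factor is the Schur complement of \<open>H\<close>, with \<open>w\<close> in
  the role of \<open>- r\<close> times the inverse of \<open>H\<close>.\<close>

lemma det_bordered_matrix_eliminate_row:
  fixes H :: "'a::comm_ring_1 ^ 'm ^ 'm"
  assumes "w v* H = - r"
  shows "det (bordered_matrix a r c H) = (a + (\<Sum>k\<in>UNIV. w $ k * c $ k)) * det H"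
proof -
  have "bordered_matrix 1 w 0 (mat 1) ** bordered_matrix a r c H =
      bordered_matrix (a + (\<Sum>k\<in>UNIV. w $ k * c $ k)) 0 c H"
    using assms by (simp add: bordered_matrix_mult option_matrix_eq_iff)
  from arg_cong[OF this, of det] show ?thesis
    by (simp add: det_mul det_bordered_matrix_lower det_bordered_matrix_upper)
qed

lemma det_distance_form:
  fixes H :: "'a::comm_ring_1 ^ 'm ^ 'm"
  shows "det (bordered_matrix 0 u u (\<chi> i j. u $ i + u $ j + H $ i $ j)) =
    det (bordered_matrix 0 u u H)"
proof -
  \<comment> \<open>Left multiplication by \<open>?P\<close> adds the first row to every other row,
    right multiplication by its transpose does so for columns; both have determinant 1.\<close>
  let ?P = "bordered_matrix 1 0 1 (mat 1) :: 'a ^ 'm option ^ 'm option"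
  have "bordered_matrix 0 u u (\<chi> i j. u $ i + u $ j + H $ i $ j) =
      ?P ** bordered_matrix 0 u u H ** transpose ?P"
    by (simp add: bordered_matrix_mult transpose_bordered_matrix option_matrix_eq_iff
        transpose_mat algebra_simps)
  then show ?thesis
    by (simp add: det_mul det_bordered_matrix_lower)
qed

lemma det_scalar_mult_matrix:
  fixes A :: "'a::comm_ring_1 ^ 'm ^ 'm"
  shows "det (\<chi> i j. c * A $ i $ j) = c ^ CARD('m) * det A"
proof -
  have "(\<chi> i j. c * A $ i $ j) = (\<chi> i. c *s A $ i)" by (simp add: vec_eq_iff)
  then show ?thesis using det_rows_mul[of "\<lambda>_. c" "\<lambda>i. A $ i"] by simp
qed

section \<open>Distances in the Hamming cube\<close>

text \<open>Coordinate differences lie in {-1, 0, 1}, where the absolute value equals the square;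
  thus the distance is the squared Euclidean one.\<close>

lemma l1_dist_hamming_cube:
  assumes "x \<in> hamming_cube" "y \<in> hamming_cube"
  shows "l1_dist x y = x \<bullet> x + y \<bullet> y - 2 * (x \<bullet> y)"
proof -
  have "\<bar>x $ k - y $ k\<bar> = x $ k * x $ k + y $ k * y $ k - 2 * (x $ k * y $ k)" for k
  proof -
    have "x $ k \<in> {0, 1}" "y $ k \<in> {0, 1}" using assms by (simp_all add: hamming_cube_def)
    then show ?thesis by auto
  qed
  then show ?thesis
    by (simp add: l1_dist_def inner_vec_def sum.distrib sum_subtractf sum_distrib_left)
qed

text \<open>Since \<open>x None\<close> is the origin, its distances to the other points form the
  border \<open>u\<close>. The lower block has the shape of \<open>det_distance_form\<close> with
  \<open>H\<close> equal to -2 times the Gram matrix.\<close>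

lemma distance_matrix_hamming_cube:
  fixes x :: "'m::finite option \<Rightarrow> real ^ 'n"
  assumes cube: "\<And>i. x i \<in> hamming_cube" and "x None = 0"
  shows "distance_matrix x = bordered_matrix 0 (gram_diagonal (x \<circ> Some)) (gram_diagonal (x \<circ> Some))
    (\<chi> i j. gram_diagonal (x \<circ> Some) $ i + gram_diagonal (x \<circ> Some) $ j
      + (\<chi> i j. (-2) * gram_matrix (x \<circ> Some) $ i $ j) $ i $ j)"
  using assms(2)
  by (simp add: option_matrix_eq_iff distance_matrix_def gram_diagonal_def gram_matrix_def
      l1_dist_hamming_cube[OF cube cube])

section \<open>Gram matrices and positive definiteness\<close>

lemma transpose_gram_matrix [simp]: "transpose (gram_matrix v) = gram_matrix v"
  by (simp add: vec_eq_iff transpose_def gram_matrix_def inner_commute)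

text \<open>Source of positive definiteness: for independent sides the right-hand side vanishes only
  at \<open>y = 0\<close>.\<close>

lemma gram_matrix_quadratic_form:
  fixes v :: "'m::finite \<Rightarrow> real ^ 'n"
  shows "(gram_matrix v *v y) \<bullet> y = (norm (\<Sum>i\<in>UNIV. y $ i *\<^sub>R v i))\<^sup>2"
proof -
  have "(gram_matrix v *v y) \<bullet> y = (\<Sum>i\<in>UNIV. (\<Sum>j\<in>UNIV. (v i \<bullet> v j) * y $ j) * y $ i)"
    by (simp add: inner_vec_def gram_matrix_def matrix_vector_mult_def)
  also have "\<dots> = (\<Sum>i\<in>UNIV. y $ i *\<^sub>R v i) \<bullet> (\<Sum>j\<in>UNIV. y $ j *\<^sub>R v j)"
    by (simp add: inner_sum_left inner_sum_right sum_distrib_left sum_distrib_right inner_commute mult_ac)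
  finally show ?thesis by (simp add: power2_norm_eq_inner)
qed

lemma independent_range_sum_zero:
  fixes v :: "'m::finite \<Rightarrow> real ^ 'n"
  assumes "inj v" "independent (range v)" "(\<Sum>i\<in>UNIV. y $ i *\<^sub>R v i) = 0"
  shows "y = 0"
proof -
  \<comment> \<open>Independence concerns the set \<open>range v\<close>; injectivity allows the
    coefficients to be reindexed by its elements.\<close>
  have "(\<Sum>a\<in>range v. (y $ inv v a) *\<^sub>R a) = 0"
    using assms(1,3) by (simp add: sum.reindex)
  then have "\<forall>a\<in>range v. y $ inv v a = 0"
    using assms(2) independentD[of "range v" "range v" "\<lambda>a. y $ inv v a"] by auto
  then show ?thesis using assms(1) by (simp add: vec_eq_iff)
qed

lemma invertible_gram_matrix:
  fixes v :: "'m::finite \<Rightarrow> real ^ 'n"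
  assumes "inj v" "independent (range v)"
  shows "invertible (gram_matrix v)"
proof -
  have "y = 0" if "gram_matrix v *v y = 0" for y
    using gram_matrix_quadratic_form[of v y] that independent_range_sum_zero[OF assms] by simp
  then show ?thesis
    by (simp add: invertible_left_inverse matrix_left_invertible_ker)
qed

lemma matrix_inv_right:
  fixes A :: "'a::semiring_1 ^ 'n ^ 'm"
  assumes "invertible A"
  shows "A ** matrix_inv A = mat 1"
  using someI_ex[OF assms[unfolded invertible_def]] by (simp add: matrix_inv_def)

text \<open>For \<open>y\<close> the inverse Gram matrix applied to \<open>u\<close>, the form is
  the Gram quadratic form at \<open>y\<close>, and \<open>y\<close> is nonzero because
  \<open>u\<close> is.\<close>

lemma gram_inverse_form_pos:
  fixes v :: "'m::finite \<Rightarrow> real ^ 'n"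
  assumes "inj v" "independent (range v)" "u \<noteq> 0"
  shows "(matrix_inv (gram_matrix v) *v u) \<bullet> u > 0"
proof -
  let ?y = "matrix_inv (gram_matrix v) *v u"
  have u: "gram_matrix v *v ?y = u"
    using matrix_inv_right[OF invertible_gram_matrix[OF assms(1,2)]]
    by (simp add: matrix_vector_mul_assoc)
  then have "?y \<noteq> 0" using assms(3) by auto
  then have "(\<Sum>i\<in>UNIV. ?y $ i *\<^sub>R v i) \<noteq> 0"
    using independent_range_sum_zero[OF assms(1,2)] by blast
  then show ?thesis
    using gram_matrix_quadratic_form[of v ?y] unfolding u by (simp add: inner_commute)
qed

section \<open>Lebesgue measure of linear images\<close>

text \<open>Translating the lower corner to \<open>0\<close> meets the sign condition of
  \<open>measure_shear_interval\<close>; as \<open>h\<close> is additive, the image is merely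
  translated too.\<close>

lemma measure_shear_cbox:
  fixes m n :: "'n::finite"
  assumes "m \<noteq> n"
  defines "h \<equiv> \<lambda>v :: real ^ 'n. \<chi> i. if i = m then v $ m + v $ n else v $ i"
  shows "measure lebesgue (h ` cbox a b) = measure lebesgue (cbox a b)"
proof (cases "cbox a b = {}")
  case False
  have cbox: "cbox a b = (+) a ` cbox 0 (b - a)"
    using cbox_translation[of a 0 "b - a"] by simp
  have "h (a + y) = h a + h y" for y by (simp add: h_def vec_eq_iff)
  then have "h ` cbox a b = (+) (h a) ` h ` cbox 0 (b - a)"
    by (simp add: cbox image_image)
  then have "measure lebesgue (h ` cbox a b) = measure lebesgue (h ` cbox 0 (b - a))"
    by (simp add: measure_translation)
  also have "\<dots> = measure lebesgue (cbox 0 (b - a))"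
    unfolding h_def using False assms(1) by (intro measure_shear_interval) (auto simp: cbox)
  also have "\<dots> = measure lebesgue (cbox a b)"
    by (simp only: cbox measure_translation)
  finally show ?thesis .
qed simp

text \<open>
  The library's \<open>measure_linear_image\<close> needs a well-ordered index type, because it computes
  the determinant of a shear as that of a triangular matrix; here a row operation does it.
\<close>

lemma measure_linear_image_finite:
  fixes f :: "real ^ 'n \<Rightarrow> real ^ 'n"
  assumes "linear f" "S \<in> lmeasurable"
  shows "f ` S \<in> lmeasurable \<and> measure lebesgue (f ` S) = \<bar>det (matrix f)\<bar> * measure lebesgue S"
proof -
  define P where "P = (\<lambda>f :: real ^ 'n \<Rightarrow> real ^ 'n. \<forall>S\<in>lmeasurable. f ` S \<in> lmeasurable \<and>
    measure lebesgue (f ` S) = \<bar>det (matrix f)\<bar> * measure lebesgue S)"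
  \<comment> \<open>For maps of determinant 1 or -1 it suffices to check boxes.\<close>
  have volume_preserving: "P f" if "linear f" "\<bar>det (matrix f)\<bar> = 1"
    "\<And>a b. measure lebesgue (f ` cbox a b) = measure lebesgue (cbox a b)" for f
    unfolding P_def
  proof
    fix S :: "(real ^ 'n) set" assume "S \<in> lmeasurable"
    from measure_linear_sufficient[OF that(1) this, of 1] that(2,3)
    show "f ` S \<in> lmeasurable \<and> measure lebesgue (f ` S) = \<bar>det (matrix f)\<bar> * measure lebesgue S"
      by simp
  qed
  have "P f"
  proof (rule induct_linear_elementary[OF assms(1)])
    fix f g assume "linear f" "linear g" "P f" "P g"
    moreover have "(f \<circ> g) ` S = f ` g ` S" for S by (simp only: image_comp)
    ultimately show "P (f \<circ> g)"
      by (simp only: P_def matrix_compose det_mul abs_mult) (simp add: mult.assoc)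
  next
    fix f :: "real ^ 'n \<Rightarrow> real ^ 'n" and i
    assume f: "linear f" "\<And>x. f x $ i = 0"
    \<comment> \<open>The image lies in a coordinate hyperplane, so both sides are zero.\<close>
    have "\<not> surj f" using f(2) by (metis surjD vec_component zero_neq_one)
    then have inj: "\<not> inj f" using f(1) linear_injective_imp_surjective by blast
    then have "negligible (f ` S)" for S
      using f(1) negligible_linear_singular_image by blast
    then show "P f"
      using inj det_nz_iff_inj[OF f(1)]
      by (auto simp: P_def negligible_iff_measure)
  next
    fix c :: "'n \<Rightarrow> real"
    have "det (matrix (\<lambda>x. \<chi> i. c i * x $ i)) = prod c UNIV"
      by (simp add: axis_def matrix_def det_diagonal)
    then show "P (\<lambda>x. \<chi> i. c i * x $ i)"
      by (simp add: P_def measurable_stretch measure_stretch)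
  next
    fix m n :: 'n assume "m \<noteq> n"
    let ?h = "\<lambda>x :: real ^ 'n. \<chi> i. x $ Transposition.transpose m n i"
    have lin: "linear ?h" by (rule linearI) (simp_all add: vec_eq_iff)
    \<comment> \<open>Swapping two coordinates keeps the norm, so the map is orthogonal.\<close>
    have "(\<Sum>i\<in>UNIV. (x $ Transposition.transpose m n i)\<^sup>2) = (\<Sum>i\<in>UNIV. (x $ i)\<^sup>2)" for x :: "real ^ 'n"
      by (rule sum.reindex_bij_witness[of _ "Transposition.transpose m n" "Transposition.transpose m n"])
        simp_all
    then have orth: "orthogonal_transformation ?h"
      using lin by (simp add: orthogonal_transformation norm_vec_def L2_set_def)
    show "P ?h"
      by (rule volume_preserving[OF lin orthogonal_transformation_det[OF orth]
            measure_orthogonal_image_eq[OF orth]])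
  next
    fix m n :: 'n assume mn: "m \<noteq> n"
    let ?h = "\<lambda>x :: real ^ 'n. \<chi> i. if i = m then x $ m + x $ n else x $ i"
    have lin: "linear ?h" by (rule linearI) (simp_all add: vec_eq_iff algebra_simps)
    have "matrix ?h = (\<chi> k. if k = m then row m (mat 1) + 1 *s row n (mat 1) else row k (mat 1))"
      by (auto simp: vec_eq_iff matrix_def axis_def row_def mat_def)
    then have "det (matrix ?h) = 1"
      using det_row_operation[OF mn, of "mat 1" "1 :: real"] by simp
    then show "P ?h"
      using volume_preserving[OF lin] measure_shear_cbox[OF mn] by simp
  qed
  then show ?thesis using assms(2) by (simp add: P_def)
qed

section \<open>Parallelepiped volume as a Gram determinant\<close>

text \<open>By polarization; it lets the Gram matrix be computed in coordinates.\<close>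

lemma linear_isometry_inner:
  fixes f :: "'a::real_inner \<Rightarrow> 'b::real_inner"
  assumes "linear_isometry f"
  shows "f a \<bullet> f b = a \<bullet> b"
  using assms by (simp add: linear_isometry_def dot_norm flip: linear_add)

lemma parallelepiped_volume_squared:
  fixes v :: "'m::finite \<Rightarrow> real ^ 'n"
  assumes "inj v" "independent (range v)"
  shows "(subspace_volume TYPE('m) (parallelepiped v))\<^sup>2 = det (gram_matrix v)"
proof -
  have "dim (range v) = CARD('m)"
    using assms dim_eq_card_independent card_image by metis
  then have "dim (UNIV :: (real ^ 'm) set) = dim (span (range v))" by simp
  then obtain f :: "real ^ 'm \<Rightarrow> real ^ 'n"
    where f: "linear f" "range f = span (range v)" "\<And>x. norm (f x) = norm x"
    using isometry_subspaces[of "UNIV :: (real ^ 'm) set" "span (range v)"] by auto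
  then have iso: "linear_isometry f" by (simp add: linear_isometry_def)
  have "inj f" using f(1,3) by (metis linear_injective_0 norm_eq_zero)
  have "\<exists>w. v i = f w" for i using f(2) by (metis rangeE rangeI span_base)
  then obtain w where w: "\<And>i. v i = f (w i)" by metis
  \<comment> \<open>The columns of \<open>A\<close> are the sides in the coordinates given by
    \<open>f\<close>, so the parallelepiped is the \<open>f\<close>-image of \<open>A\<close>
    applied to the unit cube.\<close>
  define A where "A = (\<chi> i j. w j $ i)"
  have fA: "f (A *v y) = (\<Sum>i\<in>UNIV. y $ i *\<^sub>R v i)" for y
  proof -
    have "A *v y = (\<Sum>i\<in>UNIV. y $ i *\<^sub>R w i)"
      by (simp add: vec_eq_iff A_def matrix_vector_mult_def mult.commute)
    then show ?thesis by (simp add: w linear_sum linear_scale f(1))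
  qed
  have "parallelepiped v = f ` (*v) A ` cbox 0 1"
  proof -
    have "(\<Sum>k\<in>UNIV. t k *\<^sub>R v k) \<in> (\<lambda>y. \<Sum>i\<in>UNIV. y $ i *\<^sub>R v i) ` cbox 0 1"
      if "\<forall>k. t k \<in> {0..1}" for t
      using that by (intro image_eqI[of _ _ "\<chi> k. t k"]) (auto simp: mem_box_cart)
    then show ?thesis
      by (auto simp: parallelepiped_def image_image fA mem_box_cart)
  qed
  moreover from this have "parallelepiped v \<subseteq> range f" by auto
  ultimately have "subspace_volume TYPE('m) (parallelepiped v) = measure lebesgue ((*v) A ` cbox 0 1)"
    using subspace_volume_eq[OF iso] inj_vimage_image_eq[OF \<open>inj f\<close>] by metis
  also have "\<dots> = \<bar>det A\<bar>"
    using measure_linear_image_finite[of "(*v) A" "cbox 0 1"]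
    by (simp add: content_cbox_cart interval_ne_empty_cart)
  finally have "subspace_volume TYPE('m) (parallelepiped v) = \<bar>det A\<bar>" .
  moreover have "gram_matrix v = transpose A ** A"
    unfolding gram_matrix_def w linear_isometry_inner[OF iso]
    by (simp add: vec_eq_iff A_def matrix_matrix_mult_def transpose_def inner_vec_def)
  ultimately show ?thesis by (simp add: det_mul power2_eq_square)
qed

section \<open>The determinant of the distance matrix\<close>

lemma det_distance_matrix_hamming_cube:
  fixes x :: "'m::finite option \<Rightarrow> real ^ 'n"
  assumes "\<And>i. x i \<in> hamming_cube" "x None = 0" "invertible (gram_matrix (x \<circ> Some))"
  shows "det (distance_matrix x) = (-1) ^ CARD('m) * 2 ^ (CARD('m) - 1) * det (gram_matrix (x \<circ> Some))
    * ((matrix_inv (gram_matrix (x \<circ> Some)) *v gram_diagonal (x \<circ> Some)) \<bullet> gram_diagonal (x \<circ> Some))"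
proof -
  define G where "G = gram_matrix (x \<circ> Some)"
  define u where "u = gram_diagonal (x \<circ> Some)"
  define H where "H = (\<chi> i j. (-2) * G $ i $ j)"
  \<comment> \<open>The factor 1/2 comes from \<open>H\<close> being -2 times \<open>G\<close>: it
    gives \<open>w v* H = - u\<close>.\<close>
  define w where "w = (1/2) *\<^sub>R (matrix_inv G *v u)"
  have "w v* H = - (transpose G *v (matrix_inv G *v u))"
    by (simp add: vec_eq_iff w_def H_def vector_matrix_mult_def matrix_vector_mult_def transpose_def
        sum_negf mult.commute)
  also have "\<dots> = - u"
    using matrix_inv_right[OF assms(3)] by (simp add: G_def matrix_vector_mul_assoc)
  finally have "det (bordered_matrix 0 u u H) = (w \<bullet> u) * det H"
    using det_bordered_matrix_eliminate_row[of w H u 0 u] by (simp add: inner_vec_def)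
  then have "det (distance_matrix x) = (w \<bullet> u) * det H"
    using distance_matrix_hamming_cube[of x] assms(1,2) det_distance_form[of u H]
    by (simp add: u_def H_def G_def)
  moreover have "det H = (-2) ^ CARD('m) * det G"
    unfolding H_def by (rule det_scalar_mult_matrix)
  \<comment> \<open>The factor 2 cancels the 1/2 in \<open>w\<close>. Index types are nonempty, so
    the subtraction in the exponent does not truncate.\<close>
  moreover have "(-2 :: real) ^ CARD('m) = 2 * ((-1) ^ CARD('m) * 2 ^ (CARD('m) - 1))"
    by (cases "CARD('m)") (simp_all add: power_minus[of 2])
  ultimately show ?thesis
    by (simp add: w_def G_def u_def)
qed

theorem theorem2p4:
  fixes x :: "'m::finite option \<Rightarrow> real ^ 'n"
    and v :: "'m \<Rightarrow> real ^ 'n"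
    and D :: "real ^ 'm option ^ 'm option"
    and G :: "real ^ 'm ^ 'm"
    and u :: "real ^ 'm"
    and V :: real
  defines "v \<equiv> (\<lambda>i. x (Some i))"
    and "D \<equiv> distance_matrix x"
    and "G \<equiv> gram_matrix v"
    and "u \<equiv> gram_diagonal v"
    and "V \<equiv> subspace_volume TYPE('m) (parallelepiped v)"
  assumes "CARD('n) \<ge> 2"
    and "\<And>i. x i \<in> hamming_cube"
    and "inj x"
    and "x None = 0"
    and "independent (range v)"
  shows "det D = (-1) ^ CARD('m) * 2 ^ (CARD('m) - 1) * det G * ((matrix_inv G *v u) \<bullet> u)
       \<and> (-1) ^ CARD('m) * 2 ^ (CARD('m) - 1) * det G * ((matrix_inv G *v u) \<bullet> u)
           = (-1) ^ CARD('m) * 2 ^ (CARD('m) - 1) * V\<^sup>2 * ((matrix_inv G *v u) \<bullet> u)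
       \<and> det D \<noteq> 0"
proof -
  have v: "v = x \<circ> Some" by (simp add: v_def comp_def)
  have ind: "independent (range v)" using assms(10) .
  have "inj v" using assms(8) by (simp add: v inj_compose)
  have det: "det D = (-1) ^ CARD('m) * 2 ^ (CARD('m) - 1) * det G * ((matrix_inv G *v u) \<bullet> u)"
    using det_distance_matrix_hamming_cube[of x] assms(7,9) invertible_gram_matrix[OF \<open>inj v\<close> ind]
    by (simp add: D_def G_def u_def v)
  have vol: "V\<^sup>2 = det G"
    using parallelepiped_volume_squared[OF \<open>inj v\<close> ind] by (simp add: V_def G_def)
  \<comment> \<open>An independent set omits zero, so every entry of \<open>u\<close> is nonzero; an
    entry exists because \<open>'m\<close> is nonempty.\<close>
  have "v i \<noteq> 0" for i using ind dependent_zero by (metis rangeI)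
  then have "u \<noteq> 0" by (simp add: u_def gram_diagonal_def vec_eq_iff)
  then have "(matrix_inv G *v u) \<bullet> u > 0"
    unfolding G_def by (rule gram_inverse_form_pos[OF \<open>inj v\<close> ind])
  moreover have "det G \<noteq> 0"
    using invertible_gram_matrix[OF \<open>inj v\<close> ind] by (simp add: G_def invertible_det_nz)
  ultimately have "det D \<noteq> 0" using det by simp
  then show ?thesis using det vol by simp
qed

end
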